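(* Let $\mathbf X=(X(\mathbf t),\ \mathbf t\in T)$ be a centered real-valued Gaussian random field with continuous sample paths on a compact set $T\subset\mathbb R^d$, with covariance function $R_{\mathbf X}$. Let $K_1\subset T$ be nonempty and compact, let $\mathbf b\in T$ with $\mathrm{Var}(X(\mathbf b))>0$, and let $0<r\le1$. Define $$R^{(1)}_{\mathbf X}(\mathbf t_1,\mathbf t_2)=R_{\mathbf X}(\mathbf t_1,\mathbf t_2)R_{\mathbf X}(\mathbf b,\mathbf b)-R_{\mathbf X}(\mathbf t_1,\mathbf b)R_{\mathbf X}(\mathbf t_2,\mathbf b),$$ $$R^{(2)}_{\mathbf X}(\mathbf t_1,\mathbf t_2)=r^2R_{\mathbf X}(\mathbf t_1,\mathbf t_2)-r\bigl(R_{\mathbf X}(\mathbf t_1,\mathbf b)+R_{\mathbf X}(\mathbf t_2,\mathbf b)\bigr)+R_{\mathbf X}(\mathbf b,\mathbf b),$$ and consider the optimization problem $$\min_{\mu\in M_1^+(K_1)}\frac{\int_{K_1}\int_{K_1}R^{(1)}_{\mathbf X}(\mathbf t_1,\mathbf t_2)\,\mu(d\mathbf t_1)\mu(d\mathbf t_2)}{\int_{K_1}\int_{K_1}R^{(2)}_{\mathbf X}(\mathbf t_1,\mathbf t_2)\,\mu(d\mathbf t_1)\mu(d\mathbf t_2)}\qquad(\mathrm{P})$$ subject to $$\int_{K_1}R_{\mathbf X}(\mathbf t,\mathbf b)\,\mu(d\mathbf t)\ \ge\ r\int_{K_1}\int_{K_1}R_{\mathbf X}(\mathbf t_1,\mathbf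 t_2)\,\mu(d\mathbf t_1)\mu(d\mathbf t_2).\qquad(\mathrm{C})$$ Let $\mu\in M_1^+(K_1)$ be such that (C) holds as a strict inequality. Suppose that $\mu$ is optimal in the problem (P) subject to (C), and that $$\int_{K_1}\int_{K_1}R^{(2)}_{\mathbf X}(\mathbf t_1,\mathbf t_2)\,\mu(d\mathbf t_1)\mu(d\mathbf t_2)>0.$$ Then $$\int_{K_1}R^{(1)}_{\mathbf X}(\mathbf t_1,\mathbf t)\,\mu(d\mathbf t_1)\int_{K_1}\int_{K_1}R^{(2)}_{\mathbf X}(\mathbf t_1,\mathbf t_2)\,\mu(d\mathbf t_1)\mu(d\mathbf t_2)\ \ge\ \int_{K_1}R^{(2)}_{\mathbf X}(\mathbf t_1,\mathbf t)\,\mu(d\mathbf t_1)\int_{K_1}\int_{K_1}R^{(1)}_{\mathbf X}(\mathbf t_1,\mathbf t_2)\,\mu(d\mathbf t_1)\mu(d\mathbf t_2)$$ for every $\mathbf t\in K_1$. Moreover, this holds as an equality for $\mu$-almost every $\mathbf t$.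
   Context: $R_{\mathbf X}(\mathbf s,\mathbf t)=\mathrm{cov}(X(\mathbf s),X(\mathbf t))$. $M_1^+(K_1)$ is the set of Borel probability measures on $K_1$. Both $R^{(1)}_{\mathbf X}$ and $R^{(2)}_{\mathbf X}$ are nonnegative definite, so numerator and denominator in (P) are nonnegative. At a measure $\nu$ satisfying (C) for which the denominator vanishes, the numerator vanishes too and (C) is an equality; the ratio is then given the value $\int_{K_1}\int_{K_1}R_{\mathbf X}\,d\nu\,d\nu$. A measure is optimal if it satisfies (C) and its ratio is no larger than that of any other measure in $M_1^+(K_1)$ satisfying (C). *)

theory Defs
  imports "HOL-Probability.Probability"
begin

definition covariance :: "'w measure \<Rightarrow> ('w \<Rightarrow> real) \<Rightarrow> ('w \<Rightarrow> real) \<Rightarrow> real" where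
  "covariance M Y Z =
     (\<integral>\<omega>. (Y \<omega> - (\<integral>\<omega>'. Y \<omega>' \<partial>M)) * (Z \<omega> - (\<integral>\<omega>'. Z \<omega>' \<partial>M)) \<partial>M)"

(* Almost surely constant variables count as Gaussian (variance 0): the field may be degenerate. *)
definition gaussian_rv :: "'w measure \<Rightarrow> ('w \<Rightarrow> real) \<Rightarrow> bool" where
  "gaussian_rv M Y \<longleftrightarrow>
     Y \<in> borel_measurable M \<and>
     ((\<exists>m. AE \<omega> in M. Y \<omega> = m) \<or>
      (\<exists>m \<sigma>. 0 < \<sigma> \<and> distributed M lborel Y (normal_density m \<sigma>)))"

(* All finite-dimensional distributions are (possibly degenerate) multivariate normal,
   i.e. every finite linear combination is Gaussian. *)
definition gaussian_field :: "'w measure \<Rightarrow> 't set \<Rightarrow> ('t \<Rightarrow> 'w \<Rightarrow> real) \<Rightarrow> bool" where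
  "gaussian_field M T X \<longleftrightarrow>
     prob_space M \<and>
     (\<forall>F c. finite F \<longrightarrow> F \<subseteq> T \<longrightarrow> gaussian_rv M (\<lambda>\<omega>. \<Sum>t\<in>F. c t * X t \<omega>))"

definition centered_field :: "'w measure \<Rightarrow> 't set \<Rightarrow> ('t \<Rightarrow> 'w \<Rightarrow> real) \<Rightarrow> bool" where
  "centered_field M T X \<longleftrightarrow> (\<forall>t\<in>T. (\<integral>\<omega>. X t \<omega> \<partial>M) = 0)"

(* Only almost all sample paths are required to be continuous, which includes the case
   that all of them are. *)
definition continuous_paths ::
    "'w measure \<Rightarrow> 't::topological_space set \<Rightarrow> ('t \<Rightarrow> 'w \<Rightarrow> real) \<Rightarrow> bool" where
  "continuous_paths M T X \<longleftrightarrow> (AE \<omega> in M. continuous_on T (\<lambda>t. X t \<omega>))"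

definition cov_fun :: "'w measure \<Rightarrow> ('t \<Rightarrow> 'w \<Rightarrow> real) \<Rightarrow> 't \<Rightarrow> 't \<Rightarrow> real" where
  "cov_fun M X s t = covariance M (X s) (X t)"

(* The measures live on the subspace K itself: if \<mu> is in prob_measures_on K then
   space \<mu> = K, so integration against \<mu> is integration over K. *)
definition prob_measures_on :: "'t::topological_space set \<Rightarrow> 't measure set" where
  "prob_measures_on K = {\<mu>. prob_space \<mu> \<and> sets \<mu> = sets (restrict_space borel K)}"

definition double_integral :: "'t measure \<Rightarrow> ('t \<Rightarrow> 't \<Rightarrow> real) \<Rightarrow> real" where
  "double_integral \<mu> f = (\<integral>t\<^sub>1. (\<integral>t\<^sub>2. f t\<^sub>1 t\<^sub>2 \<partial>\<mu>) \<partial>\<mu>)"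

definition R1 :: "('t \<Rightarrow> 't \<Rightarrow> real) \<Rightarrow> 't \<Rightarrow> 't \<Rightarrow> 't \<Rightarrow> real" where
  "R1 R b t\<^sub>1 t\<^sub>2 = R t\<^sub>1 t\<^sub>2 * R b b - R t\<^sub>1 b * R t\<^sub>2 b"

definition R2 :: "('t \<Rightarrow> 't \<Rightarrow> real) \<Rightarrow> 't \<Rightarrow> real \<Rightarrow> 't \<Rightarrow> 't \<Rightarrow> real" where
  "R2 R b r t\<^sub>1 t\<^sub>2 = r\<^sup>2 * R t\<^sub>1 t\<^sub>2 - r * (R t\<^sub>1 b + R t\<^sub>2 b) + R b b"

(* If the denominator vanishes at a measure satisfying the constraint, the numerator vanishes
   too, and the ratio 0/0 is assigned the value double_integral \<mu> R by convention. *)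
definition objective :: "('t \<Rightarrow> 't \<Rightarrow> real) \<Rightarrow> 't \<Rightarrow> real \<Rightarrow> 't measure \<Rightarrow> real" where
  "objective R b r \<mu> =
     (if double_integral \<mu> (R2 R b r) = 0 then double_integral \<mu> R
      else double_integral \<mu> (R1 R b) / double_integral \<mu> (R2 R b r))"

definition satisfies_C :: "('t \<Rightarrow> 't \<Rightarrow> real) \<Rightarrow> 't \<Rightarrow> real \<Rightarrow> 't measure \<Rightarrow> bool" where
  "satisfies_C R b r \<mu> \<longleftrightarrow> (\<integral>t. R t b \<partial>\<mu>) \<ge> r * double_integral \<mu> R"

definition optimal ::
    "('t::topological_space \<Rightarrow> 't \<Rightarrow> real) \<Rightarrow> 't \<Rightarrow> real \<Rightarrow> 't set \<Rightarrow> 't measure \<Rightarrow> bool" where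
  "optimal R b r K \<mu> \<longleftrightarrow>
     \<mu> \<in> prob_measures_on K \<and> satisfies_C R b r \<mu> \<and>
     (\<forall>\<nu>\<in>prob_measures_on K. satisfies_C R b r \<nu> \<longrightarrow> objective R b r \<mu> \<le> objective R b r \<nu>)"

end

theory Submission
  imports Defs
begin

text \<open>
  Moving \<open>\<mu>\<close> slightly towards a point mass, \<open>\<nu>\<^sub>\<epsilon> = (1 - \<epsilon>) \<mu> + \<epsilon> \<delta>\<^sub>t\<close>, keeps the strict
  constraint and the positive denominator for small \<open>\<epsilon>\<close>, so optimality applies to \<open>\<nu>\<^sub>\<epsilon>\<close>. Both
  energies are quadratic in \<open>\<epsilon>\<close>, and the coefficient of the first order term of the resulting
  inequality is the claimed one. Integrating it over \<open>t\<close> gives equality, hence equality almost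
  everywhere. All integrals make sense because the covariance is continuous: for a centered
  Gaussian \<open>Y\<close> one has \<open>E cos Y = exp (- E Y\<^sup>2 / 2)\<close>, so \<open>E (X\<^sub>s + X\<^sub>t)\<^sup>2\<close> is continuous in
  \<open>(s, t)\<close> by dominated convergence, and polarization recovers the covariance.
\<close>

section \<open>Second moments of centered Gaussian variables, read off from the expected
  cosine\<close>

text \<open>Real part of the characteristic function of the standard normal law at \<sigma>.\<close>

lemma integral_cos_std_normal:
  "(\<integral>x. std_normal_density x * cos (\<sigma> * x) \<partial>lborel) = exp (- (\<sigma>\<^sup>2 / 2))"
proof -
  let ?N = "std_normal_distribution"
  interpret real_distribution ?N
    by (rule real_dist_normal_dist)
  have "complex_of_real (exp (- (\<sigma>\<^sup>2 / 2))) = (CLINT x|?N. iexp (\<sigma> * x))"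
    using char_std_normal_distribution by (simp add: char_def fun_eq_iff)
  moreover have "complex_integrable ?N (\<lambda>x. iexp (\<sigma> * x))"
    by (rule integrable_iexp) auto
  ultimately have "exp (- (\<sigma>\<^sup>2 / 2)) = (LINT x|?N. Re (iexp (\<sigma> * x)))"
    by (metis Re_complex_of_real integral_Re)
  also have "\<dots> = (LINT x|?N. cos (\<sigma> * x))"
    by (simp add: Re_exp)
  also have "\<dots> = (\<integral>x. std_normal_density x * cos (\<sigma> * x) \<partial>lborel)"
    by (subst integral_density) auto
  finally show ?thesis by simp
qed

text \<open>The second conclusion encodes the variance in the expectation of a bounded function,
  which makes passing to limits easy. The almost surely constant case is treated apart because
  \<open>gaussian_rv\<close> gives it no density; there \<open>Y\<close> vanishes almost surely and
  both sides are 1.\<close>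

lemma centered_gaussian_rv:
  assumes "prob_space M" and g: "gaussian_rv M Y" and m0: "(\<integral>\<omega>. Y \<omega> \<partial>M) = 0"
  shows "integrable M (\<lambda>\<omega>. (Y \<omega>)\<^sup>2)"
    and "(\<integral>\<omega>. cos (Y \<omega>) \<partial>M) = exp (- ((\<integral>\<omega>. (Y \<omega>)\<^sup>2 \<partial>M) / 2))"
proof -
  interpret prob_space M by fact
  have Y[measurable]: "Y \<in> borel_measurable M" using g by (simp add: gaussian_rv_def)
  have "integrable M (\<lambda>\<omega>. (Y \<omega>)\<^sup>2) \<and>
        (\<integral>\<omega>. cos (Y \<omega>) \<partial>M) = exp (- ((\<integral>\<omega>. (Y \<omega>)\<^sup>2 \<partial>M) / 2))"
  proof (cases "\<exists>m. AE \<omega> in M. Y \<omega> = m")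
    case True
    then obtain m where m: "AE \<omega> in M. Y \<omega> = m" by blast
    have "(\<integral>\<omega>. Y \<omega> \<partial>M) = (\<integral>\<omega>. m \<partial>M)"
      by (rule integral_cong_AE) (use m in auto)
    then have "m = 0" using m0 by (simp add: prob_space)
    then have AE0: "AE \<omega> in M. Y \<omega> = 0" using m by simp
    have sq: "AE \<omega> in M. (Y \<omega>)\<^sup>2 = 0" using AE0 by eventually_elim simp
    have "integrable M (\<lambda>\<omega>. (Y \<omega>)\<^sup>2) \<longleftrightarrow> integrable M (\<lambda>\<omega>. 0 :: real)"
      by (rule integrable_cong_AE) (use sq in auto)
    moreover have "(\<integral>\<omega>. (Y \<omega>)\<^sup>2 \<partial>M) = (\<integral>\<omega>. 0 \<partial>M)"
      by (rule integral_cong_AE) (use sq in auto)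
    moreover have "(\<integral>\<omega>. cos (Y \<omega>) \<partial>M) = (\<integral>\<omega>. 1 \<partial>M)"
      by (rule integral_cong_AE) (use AE0 in auto)
    ultimately show ?thesis by (simp add: prob_space)
  next
    case False
    then obtain m \<sigma> where \<sigma>: "0 < \<sigma>" and D: "distributed M lborel Y (normal_density m \<sigma>)"
      using g by (auto simp: gaussian_rv_def)
    have "m = 0"
      using normal_distributed_expectation[OF \<sigma> D] m0 by simp
    with D have D: "distributed M lborel Y (normal_density 0 \<sigma>)" by simp
    \<comment> \<open>Dividing by \<sigma> reduces to the standard normal law; \<sigma> reappears as
      the frequency in the cosine.\<close>
    have "distributed M lborel (\<lambda>\<omega>. 0 + Y \<omega> * inverse \<sigma>) (normal_density (0 + 0 * inverse \<sigma>) (\<bar>inverse \<sigma>\<bar> * \<sigma>))"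
      using normal_density_affine[OF D \<sigma>, of "inverse \<sigma>" 0] \<sigma> by (simp add: mult_ac)
    then have Z: "distributed M lborel (\<lambda>\<omega>. Y \<omega> / \<sigma>) std_normal_density"
      using \<sigma> by (simp add: divide_inverse)
    have "integrable lborel (\<lambda>x. normal_density 0 \<sigma> x * x\<^sup>2)"
      using integrable_normal_moment[OF \<sigma>, of 0 2] by simp
    then have int: "integrable M (\<lambda>\<omega>. (Y \<omega>)\<^sup>2)"
      using distributed_integrable[OF D, of "\<lambda>x. x\<^sup>2"] by simp
    have v: "(\<integral>\<omega>. (Y \<omega>)\<^sup>2 \<partial>M) = \<sigma>\<^sup>2"
      using normal_distributed_variance[OF \<sigma> D] m0 by simp
    have "(\<integral>\<omega>. cos (Y \<omega>) \<partial>M) = (\<integral>\<omega>. cos (\<sigma> * (Y \<omega> / \<sigma>)) \<partial>M)"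
      using \<sigma> by simp
    also have "\<dots> = (\<integral>x. std_normal_density x * cos (\<sigma> * x) \<partial>lborel)"
      by (rule distributed_integral[OF Z, symmetric]) auto
    finally show ?thesis using int v by (simp add: integral_cos_std_normal)
  qed
  then show "integrable M (\<lambda>\<omega>. (Y \<omega>)\<^sup>2)"
    and "(\<integral>\<omega>. cos (Y \<omega>) \<partial>M) = exp (- ((\<integral>\<omega>. (Y \<omega>)\<^sup>2 \<partial>M) / 2))" by auto
qed

section \<open>Continuity of the covariance function of the field\<close>

lemma gaussian_field_sum:
  assumes "gaussian_field M T X" "finite F" "F \<subseteq> T"
  shows "gaussian_rv M (\<lambda>\<omega>. \<Sum>t\<in>F. c t * X t \<omega>)"
  using assms unfolding gaussian_field_def by blast

lemma gaussian_field_add: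
  assumes "gaussian_field M T X" "s \<in> T" "t \<in> T"
  shows "gaussian_rv M (\<lambda>\<omega>. X s \<omega> + X t \<omega>)"
\<comment> \<open>On the diagonal the index set \<open>{s, t}\<close> collapses to a singleton, so
  the coefficient 2 has to produce the sum.\<close>
proof (cases "s = t")
  case True
  then show ?thesis
    using gaussian_field_sum[OF assms(1), of "{s}" "\<lambda>_. 2"] assms(2) by simp
next
  case False
  then show ?thesis
    using gaussian_field_sum[OF assms(1), of "{s, t}" "\<lambda>_. 1"] assms(2,3) by simp
qed

lemma gaussian_field_rv:
  assumes "gaussian_field M T X" "s \<in> T"
  shows "gaussian_rv M (X s)"
  using gaussian_field_sum[OF assms(1), of "{s}" "\<lambda>_. 1"] assms(2) by simp

text \<open>Path continuity gives almost sure convergence of \<open>X s + X t\<close> along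
  sequences of index pairs, but offers no evident dominating function for the squares. The cosine is
  dominated by 1, and its expectation determines the second moment.\<close>

lemma continuous_on_cov_fun:
  fixes T :: "'t::metric_space set"
  assumes g: "gaussian_field M T X" and c: "centered_field M T X" and p: "continuous_paths M T X"
  shows "continuous_on (T \<times> T) (\<lambda>(s, t). cov_fun M X s t)"
proof -
  interpret prob_space M using g by (simp add: gaussian_field_def)
  have [measurable]: "X s \<in> borel_measurable M" if "s \<in> T" for s
    using gaussian_field_rv[OF g that] by (simp add: gaussian_rv_def)
  have E0: "(\<integral>\<omega>. X s \<omega> \<partial>M) = 0" if "s \<in> T" for s
    using c that by (simp add: centered_field_def)
  have sq: "integrable M (\<lambda>\<omega>. (X s \<omega>)\<^sup>2)" if "s \<in> T" for s
    using centered_gaussian_rv(1)[OF prob_space_axioms gaussian_field_rv[OF g that] E0[OF that]] .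
  have intX: "integrable M (X s)" if "s \<in> T" for s
    using square_integrable_imp_integrable[OF _ sq[OF that]] that by simp
  define Q where "Q s t = (\<integral>\<omega>. (X s \<omega> + X t \<omega>)\<^sup>2 \<partial>M)" for s t
  have E0': "(\<integral>\<omega>. X s \<omega> + X t \<omega> \<partial>M) = 0" if "s \<in> T" "t \<in> T" for s t
    using that by (simp add: intX E0)
  note add = centered_gaussian_rv[OF prob_space_axioms gaussian_field_add[OF g] E0']
  have cosQ: "(\<integral>\<omega>. cos (X s \<omega> + X t \<omega>) \<partial>M) = exp (- (Q s t / 2))" if "s \<in> T" "t \<in> T" for s t
    unfolding Q_def using add(2) that by blast
  have contC: "continuous_on (T \<times> T) (\<lambda>(s, t). \<integral>\<omega>. cos (X s \<omega> + X t \<omega>) \<partial>M)"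
    unfolding continuous_on_sequentially
  proof (intro allI ballI impI, clarsimp simp: comp_def case_prod_beta)
    fix x :: "nat \<Rightarrow> 't \<times> 't" and s t
    assume st: "s \<in> T" "t \<in> T" and xT: "\<forall>n. x n \<in> T \<times> T" and lim: "x \<longlonglongrightarrow> (s, t)"
    have xT': "fst (x n) \<in> T" "snd (x n) \<in> T" for n
      using xT by (auto simp: mem_Times_iff)
    show "(\<lambda>n. \<integral>\<omega>. cos (X (fst (x n)) \<omega> + X (snd (x n)) \<omega>) \<partial>M)
            \<longlonglongrightarrow> (\<integral>\<omega>. cos (X s \<omega> + X t \<omega>) \<partial>M)"
    proof (rule integral_dominated_convergence[where w = "\<lambda>_. 1"])
      show "AE \<omega> in M. (\<lambda>n. cos (X (fst (x n)) \<omega> + X (snd (x n)) \<omega>)) \<longlonglongrightarrow> cos (X s \<omega> + X t \<omega>)"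
        using p unfolding continuous_paths_def
      proof eventually_elim
        fix \<omega> assume co: "continuous_on T (\<lambda>t. X t \<omega>)"
        have "(\<lambda>n. X (fst (x n)) \<omega>) \<longlonglongrightarrow> X s \<omega>"
          using co tendsto_fst[OF lim] st xT' by (simp add: continuous_on_sequentially comp_def)
        moreover have "(\<lambda>n. X (snd (x n)) \<omega>) \<longlonglongrightarrow> X t \<omega>"
          using co tendsto_snd[OF lim] st xT' by (simp add: continuous_on_sequentially comp_def)
        ultimately show "(\<lambda>n. cos (X (fst (x n)) \<omega> + X (snd (x n)) \<omega>)) \<longlonglongrightarrow> cos (X s \<omega> + X t \<omega>)"
          by (intro tendsto_intros)
      qed
    qed (use st xT' in auto)
  qed
  \<comment> \<open>This inverts \<open>cosQ\<close>. The logarithm is continuous here because the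
    expected cosine equals an exponential and so is nonzero.\<close>
  have "continuous_on (T \<times> T) (\<lambda>z. - 2 * ln ((\<lambda>(s, t). \<integral>\<omega>. cos (X s \<omega> + X t \<omega>) \<partial>M) z))"
    by (intro continuous_intros contC) (auto simp: cosQ)
  then have contQ: "continuous_on (T \<times> T) (\<lambda>z. Q (fst z) (snd z))"
    by (rule continuous_on_cong[THEN iffD1, rotated 2]) (auto simp: cosQ)
  \<comment> \<open>Covers the diagonal terms \<open>Q s s\<close> and \<open>Q t t\<close> of the
    polarization below.\<close>
  have contQ': "continuous_on (T \<times> T) (\<lambda>z. Q (h z) (k z))"
    if "continuous_on (T \<times> T) h" "continuous_on (T \<times> T) k" "h ` (T \<times> T) \<subseteq> T" "k ` (T \<times> T) \<subseteq> T"
    for h k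
    using continuous_on_compose2[OF contQ continuous_on_Pair[OF that(1,2)]] that(3,4) by fastforce
  \<comment> \<open>Polarization written in \<open>Q\<close> alone: \<open>Q s s\<close> is the
    second moment of \<open>2 * X s\<close>, four times that of \<open>X s\<close>, so half of the
    latter becomes \<open>Q s s / 8\<close>.\<close>
  have R: "cov_fun M X s t = Q s t / 2 - Q s s / 8 - Q t t / 8" if "s \<in> T" "t \<in> T" for s t
  proof -
    have "Q s s = 4 * (\<integral>\<omega>. (X s \<omega>)\<^sup>2 \<partial>M)" "Q t t = 4 * (\<integral>\<omega>. (X t \<omega>)\<^sup>2 \<partial>M)"
      by (simp_all add: Q_def power_mult_distrib flip: mult_2)
    moreover have "cov_fun M X s t = (\<integral>\<omega>. ((X s \<omega> + X t \<omega>)\<^sup>2 - (X s \<omega>)\<^sup>2 - (X t \<omega>)\<^sup>2) / 2 \<partial>M)"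
      using that by (simp add: cov_fun_def covariance_def E0 power2_sum)
    moreover have "\<dots> = (Q s t - (\<integral>\<omega>. (X s \<omega>)\<^sup>2 \<partial>M) - (\<integral>\<omega>. (X t \<omega>)\<^sup>2 \<partial>M)) / 2"
      using that sq add(1)[OF that that] by (simp add: Q_def)
    ultimately show ?thesis by (simp add: field_simps)
  qed
  have "continuous_on (T \<times> T)
      (\<lambda>z. Q (fst z) (snd z) / 2 - Q (fst z) (fst z) / 8 - Q (snd z) (snd z) / 8)"
    by (intro continuous_intros contQ contQ') auto
  then show ?thesis
    by (rule continuous_on_cong[THEN iffD1, rotated 2]) (auto simp: R)
qed

lemma cov_fun_commute: "cov_fun M X s t = cov_fun M X t s"
  by (simp add: cov_fun_def covariance_def mult.commute)

section \<open>Mixtures of a measure with a point mass\<close>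

text \<open>For \<open>e\<close> in [0, 1] this is (1 - e) \<mu> + e \<delta>_t. Writing it as a
  Giry bind over a coin toss brings in the general facts on binds for total mass, sigma-algebra and
  integrals; \<open>return \<mu> t\<close> is the point mass on the sigma-algebra of \<mu>.\<close>

definition mix_point :: "real \<Rightarrow> 'a \<Rightarrow> 'a measure \<Rightarrow> 'a measure" where
  "mix_point e t \<mu> = measure_pmf (bernoulli_pmf e) \<bind> (\<lambda>x. if x then return \<mu> t else \<mu>)"

lemma
  assumes "prob_space \<mu>" "t \<in> space \<mu>"
  shows prob_space_mix_point: "prob_space (mix_point e t \<mu>)"
    and sets_mix_point: "sets (mix_point e t \<mu>) = sets \<mu>"
    and integral_mix_point: "\<lbrakk>0 \<le> e; e \<le> 1; (f :: _ \<Rightarrow> real) \<in> borel_measurable \<mu>;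
        \<And>x. x \<in> space \<mu> \<Longrightarrow> \<bar>f x\<bar> \<le> B\<rbrakk> \<Longrightarrow>
      (\<integral>x. f x \<partial>mix_point e t \<mu>) = (1 - e) * (\<integral>x. f x \<partial>\<mu>) + e * f t"
proof -
  interpret prob_space \<mu> by fact
  let ?k = "\<lambda>x. if x then return \<mu> t else \<mu>"
  \<comment> \<open>Membership of the two values is all that measurability of the kernel requires,
    since the coin toss lives on a discrete space.\<close>
  have k: "?k x \<in> space (prob_algebra \<mu>)" for x
    using assms by (auto simp: space_prob_algebra prob_space_return)
  then have m: "?k \<in> measure_pmf (bernoulli_pmf e) \<rightarrow>\<^sub>M prob_algebra \<mu>"
    by auto
  then have m': "?k \<in> measure_pmf (bernoulli_pmf e) \<rightarrow>\<^sub>M subprob_algebra \<mu>"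
    by (rule measurable_prob_algebraD)
  show "prob_space (mix_point e t \<mu>)"
    unfolding mix_point_def
    by (rule measure_pmf.prob_space_bind[OF _ m']) (use assms in \<open>auto simp: prob_space_return\<close>)
  show "sets (mix_point e t \<mu>) = sets \<mu>"
    unfolding mix_point_def by (rule sets_bind) auto
  assume e: "0 \<le> e" "e \<le> 1" and f: "f \<in> borel_measurable \<mu>"
    and B: "\<And>x. x \<in> space \<mu> \<Longrightarrow> \<bar>f x\<bar> \<le> B"
  have "(\<integral>x. f x \<partial>mix_point e t \<mu>)
      = (\<integral>x. (\<integral>y. f y \<partial>?k x) \<partial>measure_pmf (bernoulli_pmf e))"
    unfolding mix_point_def
    \<comment> \<open>\<open>B'\<close> bounds the total mass of the measures being mixed, which are
      probability measures.\<close>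
    by (rule integral_bind[OF f B m', where B' = 1])
       (use assms in \<open>auto simp: emeasure_space_1 intro: measure_pmf.finite_measure\<close>)
  also have "\<dots> = (1 - e) * (\<integral>x. f x \<partial>\<mu>) + e * f t"
    using e f assms by (simp add: integral_return)
  finally show "(\<integral>x. f x \<partial>mix_point e t \<mu>) = (1 - e) * (\<integral>x. f x \<partial>\<mu>) + e * f t" .
qed

section \<open>Integrals of continuous functions and kernels over a compact set\<close>

lemma prob_measures_onD:
  assumes "\<mu> \<in> prob_measures_on K"
  shows "prob_space \<mu>" "space \<mu> = K"
proof -
  show "prob_space \<mu>" using assms by (simp add: prob_measures_on_def)
  show "space \<mu> = K"
    using assms sets_eq_imp_space_eq[of \<mu> "restrict_space borel K"]
    by (simp add: prob_measures_on_def space_restrict_space)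
qed

lemma mix_point_in_prob_measures_on:
  assumes "\<mu> \<in> prob_measures_on K" "t \<in> K"
  shows "mix_point e t \<mu> \<in> prob_measures_on K"
  using assms prob_measures_onD[OF assms(1)]
  by (simp add: prob_measures_on_def prob_space_mix_point sets_mix_point)

lemma borel_measurable_prob_measures_on:
  fixes g :: "_ \<Rightarrow> real"
  assumes "\<mu> \<in> prob_measures_on K" "continuous_on K g"
  shows "g \<in> borel_measurable \<mu>"
proof -
  have "sets \<mu> = sets (restrict_space borel K)"
    using assms(1) by (simp add: prob_measures_on_def)
  then show ?thesis
    using borel_measurable_continuous_on_restrict[OF assms(2)] measurable_cong_sets by blast
qed

lemma compact_continuous_bounded:
  fixes g :: "_ \<Rightarrow> real"
  assumes "compact K" "continuous_on K g"
  obtains B where "\<And>x. x \<in> K \<Longrightarrow> \<bar>g x\<bar> \<le> B"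
  using compact_imp_bounded[OF compact_continuous_image[OF assms(2,1)]]
  by (auto simp: bounded_iff)

lemma integrable_prob_measures_on:
  fixes g :: "_ \<Rightarrow> real"
  assumes "\<mu> \<in> prob_measures_on K" "compact K" "continuous_on K g"
  shows "integrable \<mu> g"
proof -
  interpret prob_space \<mu> using assms(1) by (rule prob_measures_onD)
  obtain B where "\<And>x. x \<in> K \<Longrightarrow> \<bar>g x\<bar> \<le> B"
    using compact_continuous_bounded assms(2,3) by blast
  then show ?thesis
    using borel_measurable_prob_measures_on[OF assms(1,3)] prob_measures_onD(2)[OF assms(1)]
    by (intro integrable_const_bound[where B = B] AE_I2) auto
qed

lemma integral_mix_point_continuous:
  fixes g :: "_ \<Rightarrow> real"
  assumes "\<mu> \<in> prob_measures_on K" "compact K" "continuous_on K g" "t \<in> K" "0 \<le> e" "e \<le> 1"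
  shows "(\<integral>x. g x \<partial>mix_point e t \<mu>) = (1 - e) * (\<integral>x. g x \<partial>\<mu>) + e * g t"
proof -
  obtain B where "\<And>x. x \<in> K \<Longrightarrow> \<bar>g x\<bar> \<le> B"
    using compact_continuous_bounded assms(2,3) by blast
  then show ?thesis
    using assms borel_measurable_prob_measures_on[OF assms(1,3)] prob_measures_onD[OF assms(1)]
    by (intro integral_mix_point[where B = B]) auto
qed

lemma continuous_on_slice:
  assumes "continuous_on (S \<times> S) (\<lambda>(s, t). f s t)" "t \<in> S"
  shows "continuous_on S (\<lambda>s. f s t)" and "continuous_on S (\<lambda>s. f t s)"
proof -
  have "continuous_on S (\<lambda>s. (\<lambda>(s, t). f s t) (s, t))"
    by (rule continuous_on_compose2[OF assms(1)]) (use assms(2) in \<open>auto intro!: continuous_intros\<close>)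
  then show "continuous_on S (\<lambda>s. f s t)" by simp
  have "continuous_on S (\<lambda>s. (\<lambda>(s, t). f s t) (t, s))"
    by (rule continuous_on_compose2[OF assms(1)]) (use assms(2) in \<open>auto intro!: continuous_intros\<close>)
  then show "continuous_on S (\<lambda>s. f t s)" by simp
qed

text \<open>Dominated convergence, with a constant bound for \<open>f\<close> on the compact square.
  It makes the inner integral of \<open>double_integral\<close> a continuous integrand, so the facts
  on continuous functions also apply to the outer integral.\<close>

lemma continuous_on_integral_kernel:
  fixes f :: "'t::metric_space \<Rightarrow> 't \<Rightarrow> real"
  assumes \<mu>: "\<mu> \<in> prob_measures_on K" and K: "compact K"
    and f: "continuous_on (K \<times> K) (\<lambda>(s, t). f s t)"
  shows "continuous_on K (\<lambda>s. \<integral>t. f s t \<partial>\<mu>)"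
  unfolding continuous_on_sequentially
proof (intro allI ballI impI, clarsimp simp: comp_def)
  fix x :: "nat \<Rightarrow> 't" and s
  assume s: "s \<in> K" and x: "\<forall>n. x n \<in> K" and lim: "x \<longlonglongrightarrow> s"
  interpret prob_space \<mu> using \<mu> by (rule prob_measures_onD)
  obtain B where B: "\<And>z. z \<in> K \<times> K \<Longrightarrow> \<bar>(\<lambda>(s, t). f s t) z\<bar> \<le> B"
    using compact_continuous_bounded[OF compact_Times[OF K K] f] by blast
  have sp: "space \<mu> = K" using \<mu> by (rule prob_measures_onD)
  show "(\<lambda>n. \<integral>t. f (x n) t \<partial>\<mu>) \<longlonglongrightarrow> (\<integral>t. f s t \<partial>\<mu>)"
  proof (rule integral_dominated_convergence[where w = "\<lambda>_. B"])
    show "AE t in \<mu>. (\<lambda>n. f (x n) t) \<longlonglongrightarrow> f s t"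
    proof (rule AE_I2)
      fix t assume "t \<in> space \<mu>"
      then have "continuous_on K (\<lambda>s. f s t)"
        using continuous_on_slice(1)[OF f] sp by simp
      then show "(\<lambda>n. f (x n) t) \<longlonglongrightarrow> f s t"
        using s x lim by (simp add: continuous_on_sequentially comp_def)
    qed
    show "AE t in \<mu>. norm (f (x n) t) \<le> B" for n
      using B[of "(x n, _)"] x sp by (intro AE_I2) simp
  qed (use s x borel_measurable_prob_measures_on[OF \<mu> continuous_on_slice(2)[OF f]] in auto)
qed

text \<open>The one-variable mixture formula, applied to the inner and then to the outer integral,
  yields four terms; symmetry of \<open>f\<close> merges the two mixed ones.\<close>

lemma double_integral_mix_point:
  fixes f :: "'t::metric_space \<Rightarrow> 't \<Rightarrow> real"
  assumes \<mu>: "\<mu> \<in> prob_measures_on K" and K: "compact K"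
    and f: "continuous_on (K \<times> K) (\<lambda>(s, t). f s t)" and sym: "\<And>s t. f s t = f t s"
    and t: "t \<in> K" and e: "0 \<le> e" "e \<le> 1"
  shows "double_integral (mix_point e t \<mu>) f =
    (1 - e)\<^sup>2 * double_integral \<mu> f + 2 * e * (1 - e) * (\<integral>s. f s t \<partial>\<mu>) + e\<^sup>2 * f t t"
proof -
  let ?\<nu> = "mix_point e t \<mu>"
  note cont = continuous_on_integral_kernel[OF \<mu> K f] continuous_on_slice(1)[OF f t]
  have "double_integral ?\<nu> f = (\<integral>s. (1 - e) * (\<integral>u. f s u \<partial>\<mu>) + e * f s t \<partial>?\<nu>)"
    unfolding double_integral_def
    by (intro Bochner_Integration.integral_cong refl integral_mix_point_continuous[OF \<mu> K _ t e]
        continuous_on_slice(2)[OF f])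
       (simp add: prob_measures_onD(2)[OF mix_point_in_prob_measures_on[OF \<mu> t]])
  also have "\<dots> = (1 - e) * (\<integral>s. (1 - e) * (\<integral>u. f s u \<partial>\<mu>) + e * f s t \<partial>\<mu>)
      + e * ((1 - e) * (\<integral>u. f t u \<partial>\<mu>) + e * f t t)"
    by (intro integral_mix_point_continuous[OF \<mu> K _ t e] continuous_intros cont)
  also have "(\<integral>s. (1 - e) * (\<integral>u. f s u \<partial>\<mu>) + e * f s t \<partial>\<mu>)
      = (1 - e) * double_integral \<mu> f + e * (\<integral>s. f s t \<partial>\<mu>)"
    using integrable_prob_measures_on[OF \<mu> K] cont by (simp add: double_integral_def)
  also have "(\<integral>u. f t u \<partial>\<mu>) = (\<integral>s. f s t \<partial>\<mu>)"
    by (subst sym) (rule refl)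
  finally show ?thesis by (simp add: power2_eq_square algebra_simps)
qed

section \<open>First-order condition in the direction of a point mass\<close>

lemma optimal_first_order:
  fixes R :: "'t::metric_space \<Rightarrow> 't \<Rightarrow> real"
  assumes K: "compact K" and \<mu>: "\<mu> \<in> prob_measures_on K" and t: "t \<in> K"
    and R: "continuous_on (K \<times> K) (\<lambda>(s, t). R s t)" and sym: "\<And>s t. R s t = R t s"
    and Rb: "continuous_on K (\<lambda>t. R t b)"
    and C: "r * double_integral \<mu> R < (\<integral>t. R t b \<partial>\<mu>)"
    and opt: "optimal R b r K \<mu>"
    and pos: "0 < double_integral \<mu> (R2 R b r)"
    and R1: "continuous_on (K \<times> K) (\<lambda>(s, t). R1 R b s t)"
    and R2: "continuous_on (K \<times> K) (\<lambda>(s, t). R2 R b r s t)"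
  shows "(\<integral>s. R2 R b r s t \<partial>\<mu>) * double_integral \<mu> (R1 R b)
      \<le> (\<integral>s. R1 R b s t \<partial>\<mu>) * double_integral \<mu> (R2 R b r)"
proof -
  define N D n d where "N = double_integral \<mu> (R1 R b)" and "D = double_integral \<mu> (R2 R b r)"
    and "n = (\<integral>s. R1 R b s t \<partial>\<mu>)" and "d = (\<integral>s. R2 R b r s t \<partial>\<mu>)"
  \<comment> \<open>Coefficient of the second-order remainder, which disappears as \<open>e\<close>
    tends to 0.\<close>
  define h where "h = R1 R b t t * D - R2 R b r t t * N"
  \<comment> \<open>\<open>De e\<close> is the denominator at the mixture and \<open>Ce e\<close>
    the slack in the constraint there.\<close>
  define De where "De e = (1 - e)\<^sup>2 * D + 2 * e * (1 - e) * d + e\<^sup>2 * R2 R b r t t" for e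
  define Ce where "Ce e = (1 - e) * (\<integral>t. R t b \<partial>\<mu>) + e * R t b - r *
    ((1 - e)\<^sup>2 * double_integral \<mu> R + 2 * e * (1 - e) * (\<integral>s. R s t \<partial>\<mu>) + e\<^sup>2 * R t t)" for e
  have sym1: "R1 R b s u = R1 R b u s" for s u
    using sym by (simp add: R1_def mult.commute)
  have sym2: "R2 R b r s u = R2 R b r u s" for s u
    using sym by (simp add: R2_def add.commute)
  \<comment> \<open>Both are polynomials in \<open>e\<close>, so their positivity at 0, given by
    \<open>pos\<close> and \<open>C\<close>, persists for small positive \<open>e\<close>.\<close>
  have "(De \<longlongrightarrow> De 0) (at_right 0)" "(Ce \<longlongrightarrow> Ce 0) (at_right 0)"
    unfolding De_def Ce_def by (intro tendsto_intros)+
  moreover have "0 < De 0" "0 < Ce 0"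
    using pos C by (simp_all add: De_def Ce_def D_def)
  ultimately have ev: "\<forall>\<^sub>F e in at_right 0. 0 < De e" "\<forall>\<^sub>F e in at_right 0. 0 < Ce e"
    by (auto dest: order_tendstoD)
  have "\<forall>\<^sub>F e in at_right 0. e \<in> {0<..<1::real}"
    by (rule eventually_at_right_real) simp
  with ev have "\<forall>\<^sub>F e in at_right 0. 0 \<le> 2 * (1 - e) * (n * D - d * N) + e * h"
  proof eventually_elim
    case (elim e)
    let ?\<nu> = "mix_point e t \<mu>"
    have e: "0 < e" "0 \<le> e" "e \<le> 1" using elim by auto
    have \<nu>: "?\<nu> \<in> prob_measures_on K" using \<mu> t by (rule mix_point_in_prob_measures_on)
    note dbl = double_integral_mix_point[OF \<mu> K _ _ t e(2,3)]
    have D\<nu>: "double_integral ?\<nu> (R2 R b r) = De e"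
      unfolding dbl[OF R2 sym2] De_def D_def d_def ..
    have "satisfies_C R b r ?\<nu>"
      using elim unfolding satisfies_C_def dbl[OF R sym]
        integral_mix_point_continuous[OF \<mu> K Rb t e(2,3)] Ce_def by simp
    with opt \<nu> have "objective R b r \<mu> \<le> objective R b r ?\<nu>"
      by (simp add: optimal_def)
    \<comment> \<open>Both denominators are positive, so \<open>objective\<close> is the genuine
      ratio at both measures and its 0/0 convention does not intervene.\<close>
    then have "N / D \<le> double_integral ?\<nu> (R1 R b) / De e"
      using elim pos by (simp add: objective_def D\<nu> N_def D_def)
    then have "N * De e \<le> double_integral ?\<nu> (R1 R b) * D"
      using elim pos by (simp add: D_def field_simps)
    \<comment> \<open>The contributions \<open>(1 - e)\<^sup>2 * N * D\<close> on the two sides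
      cancel, and what remains has a factor \<open>e\<close>.\<close>
    then have "0 \<le> e * (2 * (1 - e) * (n * D - d * N) + e * h)"
      unfolding dbl[OF R1 sym1] De_def h_def N_def[symmetric] n_def[symmetric]
      by (simp add: power2_eq_square algebra_simps)
    with e show ?case by (simp add: zero_le_mult_iff)
  qed
  moreover have "((\<lambda>e. 2 * (1 - e) * (n * D - d * N) + e * h)
      \<longlongrightarrow> 2 * (1 - 0) * (n * D - d * N) + 0 * h) (at_right 0)"
    by (intro tendsto_intros)
  ultimately have "0 \<le> 2 * (1 - 0) * (n * D - d * N) + 0 * h"
    by (intro tendsto_lowerbound) auto
  then show ?thesis by (simp add: n_def d_def N_def D_def)
qed

section \<open>The inequality on \<open>K\<^sub>1\<close> and equality almost everywhere\<close>

theorem theorem3p2: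
  fixes M :: "'w measure"
    and X :: "real ^ 'd \<Rightarrow> 'w \<Rightarrow> real"
    and T K\<^sub>1 :: "(real ^ 'd) set"
    and b :: "real ^ 'd"
    and r :: real
    and R :: "real ^ 'd \<Rightarrow> real ^ 'd \<Rightarrow> real"
    and \<mu> :: "(real ^ 'd) measure"
  assumes "compact T"
    and "gaussian_field M T X"
    and "centered_field M T X"
    and "continuous_paths M T X"
    and "K\<^sub>1 \<noteq> {}" and "compact K\<^sub>1" and "K\<^sub>1 \<subseteq> T"
    and "b \<in> T" and "prob_space.variance M (X b) > 0"
    and "0 < r" and "r \<le> 1"
    and R_eq: "R = cov_fun M X"
    and "\<mu> \<in> prob_measures_on K\<^sub>1"
    and strict_C: "(\<integral>t. R t b \<partial>\<mu>) > r * double_integral \<mu> R"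
    and "optimal R b r K\<^sub>1 \<mu>"
    and "double_integral \<mu> (R2 R b r) > 0"
  shows "(\<forall>t\<in>K\<^sub>1.
            (\<integral>t\<^sub>1. R1 R b t\<^sub>1 t \<partial>\<mu>) * double_integral \<mu> (R2 R b r)
              \<ge> (\<integral>t\<^sub>1. R2 R b r t\<^sub>1 t \<partial>\<mu>) * double_integral \<mu> (R1 R b)) \<and>
         (AE t in \<mu>.
            (\<integral>t\<^sub>1. R1 R b t\<^sub>1 t \<partial>\<mu>) * double_integral \<mu> (R2 R b r)
              = (\<integral>t\<^sub>1. R2 R b r t\<^sub>1 t \<partial>\<mu>) * double_integral \<mu> (R1 R b))"
proof -
  have contT: "continuous_on (T \<times> T) (\<lambda>(s, t). R s t)"
    unfolding R_eq by (rule continuous_on_cov_fun) fact+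
  have R: "continuous_on (K\<^sub>1 \<times> K\<^sub>1) (\<lambda>(s, t). R s t)"
    by (rule continuous_on_subset[OF contT]) (use \<open>K\<^sub>1 \<subseteq> T\<close> in auto)
  \<comment> \<open>\<open>b\<close> may lie outside \<open>K\<^sub>1\<close>, so this is a slice of
    continuity on \<open>T \<times> T\<close> rather than of \<open>R\<close>.\<close>
  have Rb: "continuous_on K\<^sub>1 (\<lambda>t. R t b)"
    by (rule continuous_on_subset[OF continuous_on_slice(1)[OF contT \<open>b \<in> T\<close>] \<open>K\<^sub>1 \<subseteq> T\<close>])
  have sym: "R s t = R t s" for s t
    unfolding R_eq by (rule cov_fun_commute)
  have Rfst: "continuous_on (K\<^sub>1 \<times> K\<^sub>1) (\<lambda>z. R (fst z) b)"
    by (rule continuous_on_compose2[OF Rb]) (auto intro!: continuous_intros)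
  have Rsnd: "continuous_on (K\<^sub>1 \<times> K\<^sub>1) (\<lambda>z. R (snd z) b)"
    by (rule continuous_on_compose2[OF Rb]) (auto intro!: continuous_intros)
  note R' = R[unfolded case_prod_beta']
  have R1: "continuous_on (K\<^sub>1 \<times> K\<^sub>1) (\<lambda>(s, t). R1 R b s t)"
    unfolding R1_def case_prod_beta' by (intro continuous_intros R' Rfst Rsnd)
  have R2: "continuous_on (K\<^sub>1 \<times> K\<^sub>1) (\<lambda>(s, t). R2 R b r s t)"
    unfolding R2_def case_prod_beta' by (intro continuous_intros R' Rfst Rsnd)
  define N D n d where "N = double_integral \<mu> (R1 R b)" and "D = double_integral \<mu> (R2 R b r)"
    and "n t = (\<integral>s. R1 R b s t \<partial>\<mu>)" and "d t = (\<integral>s. R2 R b r s t \<partial>\<mu>)" for t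
  have le: "d t * N \<le> n t * D" if "t \<in> K\<^sub>1" for t
    unfolding N_def D_def n_def d_def
    by (rule optimal_first_order[where K = K\<^sub>1]) (fact assms R Rb sym R1 R2 that)+
  \<comment> \<open>Symmetry moves the free variable to the first argument, where
    \<open>continuous_on_integral_kernel\<close> and \<open>double_integral\<close> expect
    it.\<close>
  have n: "n = (\<lambda>t. \<integral>s. R1 R b t s \<partial>\<mu>)" and d: "d = (\<lambda>t. \<integral>s. R2 R b r t s \<partial>\<mu>)"
    using sym by (simp_all add: n_def d_def R1_def R2_def fun_eq_iff mult.commute add.commute)
  note int = integrable_prob_measures_on[OF \<open>\<mu> \<in> prob_measures_on K\<^sub>1\<close> \<open>compact K\<^sub>1\<close>]
    and cont = continuous_on_integral_kernel[OF \<open>\<mu> \<in> prob_measures_on K\<^sub>1\<close> \<open>compact K\<^sub>1\<close>]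
  have int_n: "integrable \<mu> n" unfolding n by (intro int cont R1)
  have int_d: "integrable \<mu> d" unfolding d by (intro int cont R2)
  \<comment> \<open>Both sides of \<open>le\<close> thus integrate to \<open>N * D\<close>; their
    difference is nonnegative with integral 0, hence zero almost everywhere.\<close>
  have "(\<integral>t. n t \<partial>\<mu>) = N" "(\<integral>t. d t \<partial>\<mu>) = D"
    by (simp_all add: n d N_def D_def double_integral_def)
  then have "(\<integral>t. n t * D - d t * N \<partial>\<mu>) = 0"
    using int_n int_d by simp
  moreover have "AE t in \<mu>. 0 \<le> n t * D - d t * N"
    using le prob_measures_onD(2)[OF \<open>\<mu> \<in> prob_measures_on K\<^sub>1\<close>] by (intro AE_I2) simp
  ultimately have "AE t in \<mu>. n t * D - d t * N = 0"
    using int_n int_d by (subst integral_nonneg_eq_0_iff_AE[symmetric]) auto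
  then have "AE t in \<mu>. n t * D = d t * N"
    by simp
  with le show ?thesis
    by (simp add: N_def D_def n_def d_def)
qed

end
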